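(* Let $G$ be a locally compact, compactly generated group. Assume that there exists a closed normal subgroup $E$ of $G$ that is an AU-subgroup in $G$. Assume that any centred compactly supported random walk on $G/E$ is maximally diffusive. Then any centred compactly supported random walk on $G$ is maximally diffusive.
   Context: Groups are equipped with the word norm $|g|_S=\min\{n\ge0:g\in S^n\}$ of a compact symmetric generating set $S$ and the associated word distance. AU-subgroup: a closed subgroup $E$ of a locally compact, compactly generated group $G$ is an AU-subgroup if for some (equivalently any) symmetric compact generating set $S$ of $G$ there exists $C\ge 1$ such that $|h_1h_2\cdots h_n|_S\le C\log n+C\max_i|h_i|_S$ for all $n\ge 1$ and all $h_1,\dots,h_n\in E$. Random walk of law $\mu$ (a Borel probability measure): $w_0=e$, $w_n=g_1\cdots g_n$ with $g_i$ i.i.d. of law $\mu$; it is compactly supported if $\mu$ is. Maximally diffusive: a random process $(w_n)_{n\ge0}$ in a metric space $(X,d)$ is maximally diffusive if there are $c_1,c_2>0$ with $\sup_{n\ge1}\mathbb{P}\left(\frac1{\sqrt n}\max_{i\le n}d(w_0,w_i)\ge t\right)\le c_2\exp(-c_1t^2)$ for all $t>0$. Centred: let $H$ be the subgroup generated by the support of $\mu$. The measure $\mu$ (or its random walk) is centred if the mean of the push-forward of $\mu$ under $H\to H/[H,H]\otimes\mathbb{R}$ vanishes, i.e. $\int\chi\,d\mu=0$ for every continuous homomorphism $\chi:H\to\mathbb{R}$. *)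

theory Defs
  imports "HOL-Probability.Probability" "HOL-Algebra.Generated_Groups"
begin

section \<open>Topological groups\<close>

text \<open>Groups have an explicit carrier, and the topology is a value of type \<^typ>\<open>'a topology\<close>,
  so that \<^term>\<open>G Mod E\<close> is an object of the same kind as \<^term>\<open>G\<close>. As usual, locally compact groups
  are Hausdorff.\<close>

definition topological_group :: "('a, 'b) monoid_scheme \<Rightarrow> 'a topology \<Rightarrow> bool" where
  "topological_group G T \<longleftrightarrow>
     group G \<and> topspace T = carrier G \<and>
     continuous_map (prod_topology T T) T (\<lambda>(x, y). x \<otimes>\<^bsub>G\<^esub> y) \<and>
     continuous_map T T (\<lambda>x. inv\<^bsub>G\<^esub> x)"

definition locally_compact_group :: "('a, 'b) monoid_scheme \<Rightarrow> 'a topology \<Rightarrow> bool" where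
  "locally_compact_group G T \<longleftrightarrow>
     topological_group G T \<and> Hausdorff_space T \<and> locally_compact_space T"

definition quotient_group_topology ::
    "('a, 'b) monoid_scheme \<Rightarrow> 'a topology \<Rightarrow> 'a set \<Rightarrow> 'a set topology" where
  "quotient_group_topology G T E =
     topology (\<lambda>U. U \<subseteq> carrier (G Mod E) \<and> openin T {x \<in> topspace T. E #>\<^bsub>G\<^esub> x \<in> U})"

lemma openin_quotient_group_topology:
  "openin (quotient_group_topology G T E) U \<longleftrightarrow>
     U \<subseteq> carrier (G Mod E) \<and> openin T {x \<in> topspace T. E #>\<^bsub>G\<^esub> x \<in> U}"
proof -
  have "istopology (\<lambda>U. U \<subseteq> carrier (G Mod E) \<and> openin T {x \<in> topspace T. E #>\<^bsub>G\<^esub> x \<in> U})"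
    unfolding istopology_def
  proof (intro conjI allI impI; (elim conjE)?)
    fix U V assume "openin T {x \<in> topspace T. E #>\<^bsub>G\<^esub> x \<in> U}"
      and "openin T {x \<in> topspace T. E #>\<^bsub>G\<^esub> x \<in> V}"
    then have "openin T ({x \<in> topspace T. E #>\<^bsub>G\<^esub> x \<in> U} \<inter> {x \<in> topspace T. E #>\<^bsub>G\<^esub> x \<in> V})"
      by (rule openin_Int)
    also have "{x \<in> topspace T. E #>\<^bsub>G\<^esub> x \<in> U} \<inter> {x \<in> topspace T. E #>\<^bsub>G\<^esub> x \<in> V} =
        {x \<in> topspace T. E #>\<^bsub>G\<^esub> x \<in> U \<inter> V}" by auto
    finally show "openin T {x \<in> topspace T. E #>\<^bsub>G\<^esub> x \<in> U \<inter> V}" .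
  next
    fix \<K> assume "\<forall>U\<in>\<K>. U \<subseteq> carrier (G Mod E) \<and> openin T {x \<in> topspace T. E #>\<^bsub>G\<^esub> x \<in> U}"
    then have "openin T (\<Union>U\<in>\<K>. {x \<in> topspace T. E #>\<^bsub>G\<^esub> x \<in> U})"
      by blast
    also have "(\<Union>U\<in>\<K>. {x \<in> topspace T. E #>\<^bsub>G\<^esub> x \<in> U}) = {x \<in> topspace T. E #>\<^bsub>G\<^esub> x \<in> \<Union>\<K>}"
      by auto
    finally show "openin T {x \<in> topspace T. E #>\<^bsub>G\<^esub> x \<in> \<Union>\<K>}" .
  qed auto
  then show ?thesis
    by (simp add: quotient_group_topology_def)
qed

lemma quotient_map_quotient_group_topology:
  assumes "topspace T = carrier G"
  shows "quotient_map T (quotient_group_topology G T E) (\<lambda>x. E #>\<^bsub>G\<^esub> x)"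
proof -
  have img: "(\<lambda>x. E #>\<^bsub>G\<^esub> x) ` topspace T = carrier (G Mod E)"
    using assms by (auto simp: FactGroup_def RCOSETS_def)
  then have "{x \<in> topspace T. E #>\<^bsub>G\<^esub> x \<in> carrier (G Mod E)} = topspace T"
    by auto
  then have "openin (quotient_group_topology G T E) (carrier (G Mod E))"
    by (simp add: openin_quotient_group_topology)
  then have "topspace (quotient_group_topology G T E) = carrier (G Mod E)"
    by (metis openin_quotient_group_topology openin_subset openin_topspace subset_antisym)
  then show ?thesis
    using img by (simp add: quotient_map_def openin_quotient_group_topology)
qed


section \<open>Word norms\<close>

primrec set_power :: "('a, 'b) monoid_scheme \<Rightarrow> 'a set \<Rightarrow> nat \<Rightarrow> 'a set" where
  "set_power G S 0 = {\<one>\<^bsub>G\<^esub>}"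
| "set_power G S (Suc n) = set_power G S n <#>\<^bsub>G\<^esub> S"

definition compact_generating_set ::
    "('a, 'b) monoid_scheme \<Rightarrow> 'a topology \<Rightarrow> 'a set \<Rightarrow> bool" where
  "compact_generating_set G T S \<longleftrightarrow>
     compactin T S \<and> (\<lambda>x. inv\<^bsub>G\<^esub> x) ` S = S \<and> generate G S = carrier G"

definition compactly_generated :: "('a, 'b) monoid_scheme \<Rightarrow> 'a topology \<Rightarrow> bool" where
  "compactly_generated G T \<longleftrightarrow> (\<exists>S. compact_generating_set G T S)"

definition word_norm :: "('a, 'b) monoid_scheme \<Rightarrow> 'a set \<Rightarrow> 'a \<Rightarrow> nat" where
  "word_norm G S g = (LEAST n. g \<in> set_power G S n)"

definition word_dist :: "('a, 'b) monoid_scheme \<Rightarrow> 'a set \<Rightarrow> 'a \<Rightarrow> 'a \<Rightarrow> real" where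
  "word_dist G S g h = real (word_norm G S (inv\<^bsub>G\<^esub> g \<otimes>\<^bsub>G\<^esub> h))"

text \<open>The ordered product \<open>g\<^sub>1 \<cdots> g\<^sub>n\<close>; the value \<open>g 0\<close> plays no role.\<close>

primrec ordered_prod :: "('a, 'b) monoid_scheme \<Rightarrow> (nat \<Rightarrow> 'a) \<Rightarrow> nat \<Rightarrow> 'a" where
  "ordered_prod G g 0 = \<one>\<^bsub>G\<^esub>"
| "ordered_prod G g (Suc n) = ordered_prod G g n \<otimes>\<^bsub>G\<^esub> g (Suc n)"

definition AU_subgroup :: "('a, 'b) monoid_scheme \<Rightarrow> 'a topology \<Rightarrow> 'a set \<Rightarrow> bool" where
  "AU_subgroup G T E \<longleftrightarrow>
     subgroup E G \<and> closedin T E \<and>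
     (\<exists>S. compact_generating_set G T S \<and>
       (\<exists>C\<ge>1. \<forall>n\<ge>1. \<forall>h. (\<forall>i\<in>{1..n}. h i \<in> E) \<longrightarrow>
          real (word_norm G S (ordered_prod G h n))
            \<le> C * ln (real n) + C * real (MAX i\<in>{1..n}. word_norm G S (h i))))"


section \<open>Random walks\<close>

definition borel_prob_measure :: "'a topology \<Rightarrow> 'a measure \<Rightarrow> bool" where
  "borel_prob_measure T \<mu> \<longleftrightarrow>
     prob_space \<mu> \<and> sets \<mu> = sets (sigma (topspace T) {U. openin T U})"

definition measure_support :: "'a topology \<Rightarrow> 'a measure \<Rightarrow> 'a set" where
  "measure_support T \<mu> =
     {x \<in> topspace T. \<forall>U. openin T U \<and> x \<in> U \<longrightarrow> measure \<mu> U > 0}"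

text \<open>The support is meant to be the smallest closed set of full measure. On spaces without a
  countable base a Borel measure that is not regular may fail to be carried by
  \<^term>\<open>measure_support T \<mu>\<close>, hence the second conjunct; it is automatic for Radon measures and on
  second countable spaces.\<close>

definition compactly_supported :: "'a topology \<Rightarrow> 'a measure \<Rightarrow> bool" where
  "compactly_supported T \<mu> \<longleftrightarrow>
     compactin T (measure_support T \<mu>) \<and> measure \<mu> (measure_support T \<mu>) = 1"

text \<open>The subgroup generated by the support carries the topology induced from \<^term>\<open>T\<close>. The use of
  \<^const>\<open>has_bochner_integral\<close> includes that the mean exists.\<close>

definition centred :: "('a, 'b) monoid_scheme \<Rightarrow> 'a topology \<Rightarrow> 'a measure \<Rightarrow> bool" where
  "centred G T \<mu> \<longleftrightarrow>
     (let H = generate G (measure_support T \<mu>) in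
       \<forall>\<phi> :: 'a \<Rightarrow> real.
         continuous_map (subtopology T H) euclideanreal \<phi> \<and>
         (\<forall>x\<in>H. \<forall>y\<in>H. \<phi> (x \<otimes>\<^bsub>G\<^esub> y) = \<phi> x + \<phi> y) \<longrightarrow>
         has_bochner_integral \<mu> (\<lambda>x. indicat_real H x * \<phi> x) 0)"

text \<open>The increments are realised as the coordinates \<open>\<omega> 1, \<omega> 2, \<dots>\<close> on the infinite product of
  copies of \<open>\<mu>\<close>.\<close>

definition walk_space :: "'a measure \<Rightarrow> (nat \<Rightarrow> 'a) measure" where
  "walk_space \<mu> = (\<Pi>\<^sub>M i\<in>UNIV. \<mu>)"

definition random_walk :: "('a, 'b) monoid_scheme \<Rightarrow> nat \<Rightarrow> (nat \<Rightarrow> 'a) \<Rightarrow> 'a" where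
  "random_walk G n \<omega> = ordered_prod G \<omega> n"

text \<open>If the group has no countable base, multiplication need not be measurable for the product
  \<open>\<sigma>\<close>-algebra, and the event below need not be measurable either. The outer measure equals the
  probability on measurable events, whereas \<^const>\<open>measure\<close> would assign \<open>0\<close> to all others.\<close>

definition maximally_diffusive ::
    "'w measure \<Rightarrow> ('a \<Rightarrow> 'a \<Rightarrow> real) \<Rightarrow> (nat \<Rightarrow> 'w \<Rightarrow> 'a) \<Rightarrow> bool" where
  "maximally_diffusive M d w \<longleftrightarrow>
     (\<exists>c\<^sub>1>0. \<exists>c\<^sub>2>0. \<forall>t>0.
        (SUP n\<in>{1..}. outer_measure_of M
           {\<omega> \<in> space M. 1 / sqrt (real n) * (MAX i\<in>{..n}. d (w 0 \<omega>) (w i \<omega>)) \<ge> t})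
        \<le> ennreal (c\<^sub>2 * exp (- c\<^sub>1 * t\<^sup>2)))"

end

theory Submission
  imports Defs
begin

text \<open>
  Let \<open>\<pi>\<close> be the projection of \<open>G\<close> onto \<open>G Mod E\<close> and \<open>w\<^sub>n = g\<^sub>1 \<cdots> g\<^sub>n\<close> the walk on \<open>G\<close>. Choose, for each
  \<open>i\<close>, a lift \<open>x\<^sub>i\<close> of \<open>\<pi> w\<^sub>i\<close> whose norm is at most a constant times the norm of \<open>\<pi> w\<^sub>i\<close>, with
  \<open>x\<^sub>0 = 1\<close>. Then \<open>w\<^sub>n = h\<^sub>1 \<cdots> h\<^sub>n x\<^sub>n\<close>, where \<open>h\<^sub>i = x\<^sub>i\<^sub>-\<^sub>1 g\<^sub>i x\<^sub>i\<^sup>-\<^sup>1\<close> lies in \<open>E\<close> because \<open>\<pi> (x\<^sub>i\<^sub>-\<^sub>1 g\<^sub>i) = \<pi> w\<^sub>i\<close>. The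
  norm of \<open>h\<^sub>i\<close> is at most \<open>2 max \<bar>x\<^sub>j\<bar> + k\<close> if \<open>k\<close> bounds the norm on the support of \<open>\<mu>\<close>, so the
  defining inequality of an AU-subgroup bounds \<open>\<bar>w\<^sub>n\<bar>\<close> by a constant times \<open>ln n + 1\<close> plus a constant
  times \<open>max \<bar>\<pi> w\<^sub>i\<bar>\<close> (\<open>AU_walk_bound\<close>, \<open>walk_norm_le_sqrt_plus_quotient_walk\<close>). As \<open>ln n\<close> is of lower
  order than \<open>\<surd>n\<close>, the walk on \<open>G\<close> inherits the Gaussian tail of the projected walk
  (\<open>maximally_diffusive_transfer\<close>).

  The constants exist because word norms are bounded on compact sets and because compact subsets of
  the quotient lift to sets of bounded norm. Both are instances of
  \<open>compactin_lift_word_norm_bounded\<close>, which rests on the Baire category theorem.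

  The projected walk has increments of law \<open>\<pi>\<^sub>* \<mu>\<close>, which must be compactly supported and centred.
  The first holds because the quotient is Hausdorff, so that the support of \<open>\<pi>\<^sub>* \<mu>\<close> is the image of
  the support of \<open>\<mu>\<close>. For the second, characters of the subgroup generated by the new support pull
  back to characters of the one generated by the old; the change of variables needs the new
  subgroup to be a Borel set, and it is one since it is \<open>\<sigma>\<close>-compact.
\<close>

section \<open>Word norms\<close>

lemma (in group) set_power_closed:
  assumes "S \<subseteq> carrier G"
  shows "set_power G S n \<subseteq> carrier G"
  by (induction n) (use assms set_mult_closed in auto)

lemma (in group) set_power_mult:
  assumes S: "S \<subseteq> carrier G" and x: "x \<in> set_power G S m" and y: "y \<in> set_power G S n"
  shows "x \<otimes> y \<in> set_power G S (m + n)"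
  using y
proof (induction n arbitrary: y)
  case 0
  have "x \<in> carrier G" using x set_power_closed[OF S] by blast
  then show ?case using 0 x by simp
next
  case (Suc n)
  then obtain z s where zs: "z \<in> set_power G S n" "s \<in> S" "y = z \<otimes> s"
    by (auto simp: set_mult_def)
  then have "x \<otimes> y = x \<otimes> z \<otimes> s"
    using x set_power_closed[OF S] S by (metis m_assoc subsetD)
  then show ?case
    using Suc.IH[OF zs(1)] zs(2) by (auto simp: set_mult_def)
qed

lemma (in group) subset_set_power_1: "S \<subseteq> carrier G \<Longrightarrow> S \<subseteq> set_power G S (Suc 0)"
  by (force simp: set_mult_def)

text \<open>The factors reverse their order under inversion, so the induction prepends a letter.\<close>

lemma (in group) set_power_inv:
  assumes S: "S \<subseteq> carrier G" "(\<lambda>x. inv x) ` S = S" and x: "x \<in> set_power G S n"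
  shows "inv x \<in> set_power G S n"
  using x
proof (induction n arbitrary: x)
  case 0
  then show ?case by simp
next
  case (Suc n)
  then obtain z s where zs: "z \<in> set_power G S n" "s \<in> S" "x = z \<otimes> s"
    by (auto simp: set_mult_def)
  have "inv s \<in> S" using zs(2) S(2) by blast
  then have "inv s \<in> set_power G S 1"
    using subset_set_power_1[OF S(1)] by auto
  from set_power_mult[OF S(1) this Suc.IH[OF zs(1)]]
  have "inv s \<otimes> inv z \<in> set_power G S (Suc n)" by simp
  moreover have "z \<in> carrier G" "s \<in> carrier G"
    using zs S(1) set_power_closed[OF S(1)] by blast+
  ultimately show ?case
    using zs(3) by (simp add: inv_mult_group del: set_power.simps)
qed

lemma (in group) generate_eq_UN_set_power:
  assumes S: "S \<subseteq> carrier G" "(\<lambda>x. inv x) ` S = S"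
  shows "generate G S = (\<Union>n. set_power G S n)"
proof
  show "generate G S \<subseteq> (\<Union>n. set_power G S n)"
  proof
    fix x assume "x \<in> generate G S"
    then show "x \<in> (\<Union>n. set_power G S n)"
    proof induction
      case one
      show ?case by (rule UN_I[of 0]) auto
    next
      case (incl h)
      then show ?case using subset_set_power_1[OF S(1)] by blast
    next
      case (inv h)
      then have "inv h \<in> S" using S(2) by blast
      then show ?case using subset_set_power_1[OF S(1)] by blast
    next
      case (eng h1 h2)
      then show ?case using set_power_mult[OF S(1)] by blast
    qed
  qed
  have "x \<in> generate G S" if "x \<in> set_power G S n" for n x
    using that
    by (induction n arbitrary: x) (auto simp: set_mult_def intro: generate.intros)
  then show "(\<Union>n. set_power G S n) \<subseteq> generate G S" by blast
qed

lemma (in group) generate_Un_inv: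
  assumes "K \<subseteq> carrier G"
  shows "generate G (K \<union> (\<lambda>x. inv x) ` K) = generate G K"
proof
  show "generate G K \<subseteq> generate G (K \<union> (\<lambda>x. inv x) ` K)"
    by (rule mono_generate) auto
  have "K \<union> (\<lambda>x. inv x) ` K \<subseteq> generate G K"
    by (auto intro: generate.intros)
  then show "generate G (K \<union> (\<lambda>x. inv x) ` K) \<subseteq> generate G K"
    by (rule generate_subgroup_incl[OF _ generate_is_subgroup[OF assms]])
qed

lemma word_norm_le: "x \<in> set_power G S n \<Longrightarrow> word_norm G S x \<le> n"
  unfolding word_norm_def by (rule Least_le)

lemma word_norm_one [simp]: "word_norm G S \<one>\<^bsub>G\<^esub> = 0"
  using word_norm_le[of "\<one>\<^bsub>G\<^esub>" G S 0] by simp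

locale symmetric_generating_set = group G for G (structure) +
  fixes S
  assumes subset_carrier: "S \<subseteq> carrier G"
    and inv_image: "(\<lambda>x. inv x) ` S = S"
    and generates: "generate G S = carrier G"
begin

lemma in_set_power_word_norm:
  assumes "x \<in> carrier G"
  shows "x \<in> set_power G S (word_norm G S x)"
proof -
  have "\<exists>n. x \<in> set_power G S n"
    using assms generates generate_eq_UN_set_power[OF subset_carrier inv_image] by blast
  then show ?thesis
    unfolding word_norm_def by (rule LeastI_ex)
qed

lemma word_norm_mult:
  assumes "x \<in> carrier G" "y \<in> carrier G"
  shows "word_norm G S (x \<otimes> y) \<le> word_norm G S x + word_norm G S y"
  by (intro word_norm_le set_power_mult subset_carrier in_set_power_word_norm assms)

lemma word_norm_inv:
  assumes "x \<in> carrier G"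
  shows "word_norm G S (inv x) \<le> word_norm G S x"
  by (intro word_norm_le set_power_inv subset_carrier inv_image in_set_power_word_norm assms)

end

text \<open>Lifting a product letter by letter costs at most the bound \<open>N\<close> for each letter.\<close>

lemma set_power_lift:
  assumes "group_hom G Q f" "symmetric_generating_set G S"
    and S': "\<And>y. y \<in> S' \<Longrightarrow> \<exists>x\<in>carrier G. f x = y \<and> word_norm G S x \<le> N"
    and y: "y \<in> set_power Q S' m"
  shows "\<exists>x\<in>carrier G. f x = y \<and> word_norm G S x \<le> N * m"
  using y
proof (induction m arbitrary: y)
  interpret group_hom G Q f by fact
  case 0
  then show ?case by (intro bexI[of _ "\<one>\<^bsub>G\<^esub>"]) auto
next
  interpret group_hom G Q f by fact
  interpret symmetric_generating_set G S by fact
  case (Suc m)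
  then obtain z s where zs: "z \<in> set_power Q S' m" "s \<in> S'" "y = z \<otimes>\<^bsub>Q\<^esub> s"
    by (auto simp: set_mult_def)
  obtain a where a: "a \<in> carrier G" "f a = z" "word_norm G S a \<le> N * m"
    using Suc.IH[OF zs(1)] by blast
  obtain b where b: "b \<in> carrier G" "f b = s" "word_norm G S b \<le> N"
    using S'[OF zs(2)] by blast
  have "word_norm G S (a \<otimes>\<^bsub>G\<^esub> b) \<le> N * Suc m"
    using word_norm_mult[of a b] a b by simp
  then show ?case
    using a b zs(3) by (intro bexI[of _ "a \<otimes>\<^bsub>G\<^esub> b"]) auto
qed

text \<open>With the identity for \<open>f\<close>, this compares the word norms of two generating sets of one group.\<close>

lemma word_norm_lift:
  assumes "group_hom G Q f" "symmetric_generating_set G S" "symmetric_generating_set Q S'"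
    and "\<And>y. y \<in> S' \<Longrightarrow> \<exists>x\<in>carrier G. f x = y \<and> word_norm G S x \<le> N"
    and "y \<in> carrier Q"
  shows "\<exists>x\<in>carrier G. f x = y \<and> word_norm G S x \<le> N * word_norm Q S' y"
  using set_power_lift[OF assms(1,2,4)] symmetric_generating_set.in_set_power_word_norm[OF assms(3,5)]
  by blast

section \<open>Word norms of compact sets\<close>

lemma compact_generating_set_imp_symmetric:
  assumes "group G" "topspace T = carrier G" "compact_generating_set G T S"
  shows "symmetric_generating_set G S"
  using assms compactin_subset_topspace[of T S]
  by (auto simp: compact_generating_set_def symmetric_generating_set_def
      symmetric_generating_set_axioms_def)

lemma compactin_set_power:
  assumes G: "topological_group G T" and S: "compactin T S"
  shows "compactin T (set_power G S n)"
proof (induction n)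
  case 0
  have "\<one>\<^bsub>G\<^esub> \<in> topspace T"
    using G by (auto simp: topological_group_def group.is_monoid)
  then show ?case by simp
next
  case (Suc n)
  have "compactin T ((\<lambda>(x, y). x \<otimes>\<^bsub>G\<^esub> y) ` (set_power G S n \<times> S))"
    using G Suc S by (intro image_compactin[of "prod_topology T T"])
      (auto simp: topological_group_def compactin_Times)
  moreover have "(\<lambda>(x, y). x \<otimes>\<^bsub>G\<^esub> y) ` (set_power G S n \<times> S) = set_power G S (Suc n)"
    by (auto simp: set_mult_def)
  ultimately show ?case by simp
qed

lemma openin_right_translate:
  assumes G: "topological_group G T" and "openin T U" "a \<in> carrier G"
  shows "openin T {x \<in> carrier G. x \<otimes>\<^bsub>G\<^esub> a \<in> U}"
proof -
  have "continuous_map T T ((\<lambda>(x, y). x \<otimes>\<^bsub>G\<^esub> y) \<circ> (\<lambda>x. (x, a)))"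
    using G assms by (intro continuous_map_compose[of _ "prod_topology T T"])
      (auto simp: topological_group_def continuous_map_pairwise o_def)
  from openin_continuous_map_preimage[OF this \<open>openin T U\<close>] show ?thesis
    using G by (simp add: topological_group_def)
qed

lemma openin_left_translate:
  assumes G: "topological_group G T" and "openin T U" "a \<in> carrier G"
  shows "openin T {x \<in> carrier G. a \<otimes>\<^bsub>G\<^esub> x \<in> U}"
proof -
  have "continuous_map T T ((\<lambda>(x, y). x \<otimes>\<^bsub>G\<^esub> y) \<circ> (\<lambda>x. (a, x)))"
    using G assms by (intro continuous_map_compose[of _ "prod_topology T T"])
      (auto simp: topological_group_def continuous_map_pairwise o_def)
  from openin_continuous_map_preimage[OF this \<open>openin T U\<close>] show ?thesis
    using G by (simp add: topological_group_def)
qed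

text \<open>The powers of \<open>S\<close> are countably many closed sets that cover \<open>G\<close>, so by the Baire category theorem
  some \<open>S\<^sup>n\<close> contains a nonempty open set. Translating by a point of that set
  moves it to the identity and at most doubles the bound.\<close>

lemma word_norm_bounded_near_one:
  fixes G (structure)
  assumes G: "locally_compact_group G T" and S: "compact_generating_set G T S"
  shows "\<exists>U N. openin T U \<and> \<one>\<^bsub>G\<^esub> \<in> U \<and> (\<forall>g\<in>U. word_norm G S g \<le> N)"
proof -
  have tg: "topological_group G T" and Haus: "Hausdorff_space T" and lc: "locally_compact_space T"
    using G by (auto simp: locally_compact_group_def)
  then have top: "topspace T = carrier G" and "group G"
    by (auto simp: topological_group_def)
  interpret symmetric_generating_set G S
    by (rule compact_generating_set_imp_symmetric) fact+
  define \<B> where "\<B> = range (set_power G S)"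
  have "\<Union>\<B> = topspace T"
    unfolding \<B>_def top generates[symmetric]
    using generate_eq_UN_set_power[OF subset_carrier inv_image] by simp
  then have "T interior_of \<Union>\<B> \<noteq> {}"
    using top one_closed interior_of_topspace[of T] by auto
  moreover have "closedin T B" if "B \<in> \<B>" for B
    using that compactin_set_power[OF tg] S compactin_imp_closedin[OF Haus]
    by (auto simp: \<B>_def compact_generating_set_def)
  moreover have "countable \<B>"
    by (simp add: \<B>_def)
  moreover have "regular_space T"
    using locally_compact_Hausdorff_imp_regular_space lc Haus by blast
  ultimately have "\<exists>B\<in>\<B>. T interior_of B \<noteq> {}"
    using Baire_category_alt[of T \<B>] lc by metis
  then obtain n where "T interior_of set_power G S n \<noteq> {}"
    unfolding \<B>_def by blast
  then obtain a where a: "a \<in> T interior_of set_power G S n" by blast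
  then have "a \<in> set_power G S n"
    using interior_of_subset[of T "set_power G S n"] by blast
  then have ac: "a \<in> carrier G" and an: "word_norm G S a \<le> n"
    using set_power_closed[OF subset_carrier] word_norm_le by auto
  define U where "U = {x \<in> carrier G. x \<otimes> a \<in> T interior_of set_power G S n}"
  have "word_norm G S g \<le> n + n" if "g \<in> U" for g
  proof -
    have g: "g \<in> carrier G" and "g \<otimes> a \<in> set_power G S n"
      using that interior_of_subset[of T "set_power G S n"] by (auto simp: U_def)
    then have "word_norm G S (g \<otimes> a) \<le> n"
      by (intro word_norm_le)
    moreover have "word_norm G S g \<le> word_norm G S (g \<otimes> a) + word_norm G S (inv a)"
      using word_norm_mult[of "g \<otimes> a" "inv a"] g ac by (simp add: m_assoc)
    ultimately show ?thesis
      using word_norm_inv[OF ac] an by simp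
  qed
  moreover have "openin T U"
    unfolding U_def by (rule openin_right_translate[OF tg openin_interior_of ac])
  moreover have "\<one> \<in> U"
    using a ac by (simp add: U_def)
  ultimately show ?thesis by blast
qed

text \<open>By translation of a neighbourhood of the identity on which the norm is bounded, the interiors of
  the norm balls cover \<open>G\<close>. Their images under the open surjection \<open>f\<close> form an increasing open cover of
  \<open>K\<close>, and one of them contains \<open>K\<close>. The case that \<open>f\<close> is the identity says that the norm is bounded on compact
  sets; the quotient map is the other case of interest.\<close>

lemma compactin_lift_word_norm_bounded:
  fixes G (structure)
  assumes G: "locally_compact_group G T" and S: "compact_generating_set G T S"
    and f: "open_map T Q f" "f ` topspace T = topspace Q" and K: "compactin Q K"
  shows "\<exists>N. \<forall>y\<in>K. \<exists>x\<in>carrier G. f x = y \<and> word_norm G S x \<le> N"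
proof -
  have tg: "topological_group G T"
    using G by (auto simp: locally_compact_group_def)
  then have top: "topspace T = carrier G" and "group G"
    by (auto simp: topological_group_def)
  interpret symmetric_generating_set G S
    by (rule compact_generating_set_imp_symmetric) fact+
  define V where "V n = T interior_of {x \<in> carrier G. word_norm G S x \<le> n}" for n
  have V_mono: "V m \<subseteq> V n" if "m \<le> n" for m n
    unfolding V_def by (rule interior_of_mono) (use that in auto)
  have cover: "\<exists>n. a \<in> V n" if a: "a \<in> carrier G" for a
  proof -
    obtain U N where U: "openin T U" "\<one> \<in> U" "\<And>g. g \<in> U \<Longrightarrow> word_norm G S g \<le> N"
      using word_norm_bounded_near_one[OF G S] by blast
    define W where "W = {x \<in> carrier G. x \<otimes> inv a \<in> U}"
    have "openin T W"
      unfolding W_def using a by (intro openin_right_translate[OF tg U(1)]) auto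
    moreover have "a \<in> W" using a U by (simp add: W_def)
    moreover have "W \<subseteq> {x \<in> carrier G. word_norm G S x \<le> N + word_norm G S a}"
    proof
      fix x assume x: "x \<in> W"
      then have "word_norm G S x \<le> word_norm G S (x \<otimes> inv a) + word_norm G S a"
        using word_norm_mult[of "x \<otimes> inv a" a] a by (simp add: W_def m_assoc)
      then show "x \<in> {x \<in> carrier G. word_norm G S x \<le> N + word_norm G S a}"
        using U(3)[of "x \<otimes> inv a"] x by (simp add: W_def)
    qed
    ultimately have "a \<in> V (N + word_norm G S a)"
      unfolding V_def
      using interior_of_maximal[of W "{x \<in> carrier G. word_norm G S x \<le> N + word_norm G S a}" T]
      by blast
    then show ?thesis by blast
  qed
  have op: "openin Q (f ` V n)" for n
    using f(1) openin_interior_of unfolding open_map_def V_def by blast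
  have "K \<subseteq> (\<Union>n. f ` V n)"
  proof
    fix y assume "y \<in> K"
    then obtain a where "a \<in> carrier G" "y = f a"
      using compactin_subset_topspace[OF K] f(2) top by blast
    then show "y \<in> (\<Union>n. f ` V n)" using cover by blast
  qed
  moreover have "\<forall>U\<in>range (\<lambda>n. f ` V n). openin Q U"
    using op by blast
  ultimately have "\<exists>\<F>. finite \<F> \<and> \<F> \<subseteq> range (\<lambda>n. f ` V n) \<and> K \<subseteq> \<Union>\<F>"
    using K[unfolded compactin_def, THEN conjunct2, rule_format, of "range (\<lambda>n. f ` V n)"]
    by simp
  then obtain \<F> where \<F>: "finite \<F>" "\<F> \<subseteq> range (\<lambda>n. f ` V n)" "K \<subseteq> \<Union>\<F>"
    by blast
  obtain I where I: "finite I" "\<F> = (\<lambda>n. f ` V n) ` I"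
    using finite_subset_image[OF \<F>(1,2)] by blast
  obtain N where "\<forall>i\<in>I. i \<le> N"
    using I(1) finite_nat_set_iff_bounded_le by blast
  then have "K \<subseteq> f ` V N"
    using \<F>(3) I(2) V_mono by blast
  moreover have "V N \<subseteq> {x \<in> carrier G. word_norm G S x \<le> N}"
    unfolding V_def by (rule interior_of_subset)
  ultimately have "\<forall>y\<in>K. \<exists>x\<in>carrier G. f x = y \<and> word_norm G S x \<le> N"
    by (auto dest!: subsetD)
  then show ?thesis ..
qed

section \<open>The quotient group as a topological space\<close>

lemma r_coset_group_hom:
  assumes "E \<lhd> G"
  shows "group_hom G (G Mod E) (\<lambda>x. E #>\<^bsub>G\<^esub> x)"
  using assms normal.r_coset_hom_Mod[OF assms] normal.factorgroup_is_group[OF assms]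
  by (simp add: group_hom_def group_hom_axioms_def normal_def)

lemma r_coset_eq_iff:
  fixes G (structure)
  assumes "E \<lhd> G" "x \<in> carrier G" "y \<in> carrier G"
  shows "E #> x = E #> y \<longleftrightarrow> x \<otimes> inv y \<in> E"
proof -
  interpret normal E G by fact
  have "x \<in> E #> y \<longleftrightarrow> x \<otimes> inv y \<in> E"
    using assms by (intro rcos_module is_group) auto
  then show ?thesis
    using repr_independence[of x E y] repr_independenceD[of E x y] assms is_subgroup by metis
qed

text \<open>The saturation of an open set \<open>U\<close> is the union of its translates by elements of \<open>E\<close>.\<close>

lemma open_map_quotient_group:
  fixes G (structure)
  assumes G: "topological_group G T" and E: "E \<lhd> G"
  shows "open_map T (quotient_group_topology G T E) (\<lambda>x. E #> x)"
  unfolding open_map_def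
proof (intro allI impI)
  interpret normal E G by fact
  have top: "topspace T = carrier G"
    using G by (simp add: topological_group_def)
  fix U assume U: "openin T U"
  then have Uc: "U \<subseteq> carrier G" using openin_subset top by blast
  have "{x \<in> carrier G. E #> x \<in> (\<lambda>x. E #> x) ` U} = (\<Union>e\<in>E. {x \<in> carrier G. e \<otimes> x \<in> U})"
  proof (intro equalityI subsetI)
    fix x assume "x \<in> {x \<in> carrier G. E #> x \<in> (\<lambda>x. E #> x) ` U}"
    then obtain u where xu: "x \<in> carrier G" "u \<in> U" "E #> x = E #> u" by auto
    then have "u \<otimes> inv x \<in> E"
      using r_coset_eq_iff[OF E, of u x] Uc by auto
    moreover have "u \<otimes> inv x \<otimes> x \<in> U"
      using xu Uc by (simp add: m_assoc subsetD)
    ultimately show "x \<in> (\<Union>e\<in>E. {x \<in> carrier G. e \<otimes> x \<in> U})"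
      using xu(1) by blast
  next
    fix x assume "x \<in> (\<Union>e\<in>E. {x \<in> carrier G. e \<otimes> x \<in> U})"
    then obtain e where e: "e \<in> E" "x \<in> carrier G" "e \<otimes> x \<in> U" by blast
    then have "E #> (e \<otimes> x) = E #> x"
      by (subst r_coset_eq_iff[OF E]) (auto simp: m_assoc)
    then show "x \<in> {x \<in> carrier G. E #> x \<in> (\<lambda>x. E #> x) ` U}"
      using e by (auto intro!: image_eqI[of _ _ "e \<otimes> x"])
  qed
  moreover have "openin T (\<Union>e\<in>E. {x \<in> carrier G. e \<otimes> x \<in> U})"
    using openin_left_translate[OF G U] by (intro openin_Union) auto
  ultimately show "openin (quotient_group_topology G T E) ((\<lambda>x. E #> x) ` U)"
    using Uc by (auto simp: openin_quotient_group_topology top carrier_FactGroup)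
qed

text \<open>Distinct cosets \<open>E x\<close> and \<open>E y\<close> have \<open>x y\<^sup>-\<^sup>1 \<notin> E\<close>, an open condition on the pair because \<open>E\<close> is closed. A box
  around \<open>(x, y)\<close> on which it holds projects to disjoint sets, which are open.\<close>

lemma Hausdorff_quotient_group:
  fixes G (structure)
  assumes G: "topological_group G T" and E: "E \<lhd> G" and "closedin T E"
  shows "Hausdorff_space (quotient_group_topology G T E)"
  unfolding Hausdorff_space_def
proof (intro allI impI, elim conjE)
  interpret normal E G by fact
  let ?Q = "quotient_group_topology G T E" and ?p = "\<lambda>x. E #> x"
  have top: "topspace T = carrier G"
    using G by (simp add: topological_group_def)
  have im: "?p ` carrier G = topspace ?Q"
    using quotient_map_quotient_group_topology[OF top, of E] top by (auto simp: quotient_map_def)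
  fix a b assume ab: "a \<in> topspace ?Q" "b \<in> topspace ?Q" "a \<noteq> b"
  obtain x y where xy: "x \<in> carrier G" "y \<in> carrier G" "a = ?p x" "b = ?p y"
    using ab(1,2) unfolding im[symmetric] by (elim imageE)
  have "continuous_map (prod_topology T T) T
      ((\<lambda>(x, y). x \<otimes> y) \<circ> (\<lambda>z. (fst z, inv (snd z))))"
    using G by (intro continuous_map_compose[of _ "prod_topology T T"])
      (auto simp: topological_group_def continuous_map_pairwise o_def
        intro: continuous_map_fst continuous_map_compose[OF continuous_map_snd, unfolded o_def])
  moreover have "openin T (carrier G - E)"
    using \<open>closedin T E\<close> by (simp add: closedin_def top)
  ultimately have "openin (prod_topology T T)
      {z \<in> topspace (prod_topology T T). ((\<lambda>(x, y). x \<otimes> y) \<circ> (\<lambda>z. (fst z, inv (snd z)))) z \<in> carrier G - E}"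
    by (rule openin_continuous_map_preimage)
  then have "openin (prod_topology T T) {z \<in> carrier G \<times> carrier G. fst z \<otimes> inv (snd z) \<in> carrier G - E}"
    by (simp add: top)
  moreover have "(x, y) \<in> {z \<in> carrier G \<times> carrier G. fst z \<otimes> inv (snd z) \<in> carrier G - E}"
    using xy ab(3) r_coset_eq_iff[OF E, of x y] by simp
  ultimately have "\<exists>U V. openin T U \<and> openin T V \<and> x \<in> U \<and> y \<in> V \<and>
      U \<times> V \<subseteq> {z \<in> carrier G \<times> carrier G. fst z \<otimes> inv (snd z) \<in> carrier G - E}"
    unfolding openin_prod_topology_alt by (elim allE impE)
  then obtain U V where UV: "openin T U" "openin T V" "x \<in> U" "y \<in> V"
    "U \<times> V \<subseteq> {z \<in> carrier G \<times> carrier G. fst z \<otimes> inv (snd z) \<in> carrier G - E}"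
    by (elim exE conjE)
  have "disjnt (?p ` U) (?p ` V)"
    unfolding disjnt_iff
  proof (intro allI notI, elim conjE imageE)
    fix c u v assume "c = ?p u" "u \<in> U" "c = ?p v" "v \<in> V"
    moreover from this have "(u, v) \<in> {z \<in> carrier G \<times> carrier G. fst z \<otimes> inv (snd z) \<in> carrier G - E}"
      using UV(5) by blast
    ultimately show False
      using r_coset_eq_iff[OF E, of u v] by auto
  qed
  then show "\<exists>U V. openin ?Q U \<and> openin ?Q V \<and> a \<in> U \<and> b \<in> V \<and> disjnt U V"
    using UV xy open_map_quotient_group[OF G E] unfolding open_map_def
    by (intro exI[of _ "?p ` U"] exI[of _ "?p ` V"]) auto
qed

section \<open>The norm of a walk and of its projection modulo an AU-subgroup\<close>

lemma (in group) ordered_prod_closed: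
  "(\<And>i. i \<ge> 1 \<Longrightarrow> g i \<in> carrier G) \<Longrightarrow> ordered_prod G g n \<in> carrier G"
  by (induction n) auto

lemma (in group_hom) hom_ordered_prod:
  assumes "\<And>i. i \<ge> 1 \<Longrightarrow> g i \<in> carrier G"
  shows "h (ordered_prod G g n) = ordered_prod H (\<lambda>i. h (g i)) n"
  using assms G.ordered_prod_closed[of g] by (induction n) auto

lemma (in group) ordered_prod_telescope:
  assumes "\<And>i. x i \<in> carrier G" "\<And>i. i \<ge> 1 \<Longrightarrow> g i \<in> carrier G"
  shows "ordered_prod G (\<lambda>i. x (i - 1) \<otimes> g i \<otimes> inv (x i)) n \<otimes> x n = x 0 \<otimes> ordered_prod G g n"
proof (induction n)
  case 0
  then show ?case using assms by simp
next
  case (Suc n)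
  let ?h = "\<lambda>i. x (i - 1) \<otimes> g i \<otimes> inv (x i)"
  have c: "ordered_prod G ?h n \<in> carrier G" "ordered_prod G g n \<in> carrier G" "g (Suc n) \<in> carrier G"
    using assms by (auto intro!: ordered_prod_closed)
  have "ordered_prod G ?h (Suc n) \<otimes> x (Suc n) = (ordered_prod G ?h n \<otimes> x n) \<otimes> g (Suc n)"
    using c assms(1) by (simp add: m_assoc)
  also have "\<dots> = x 0 \<otimes> ordered_prod G g (Suc n)"
    unfolding Suc.IH using c assms(1) by (simp add: m_assoc)
  finally show ?case .
qed

text \<open>The lifts \<open>x i\<close> of the projected walk differ from the walk by elements of \<open>E\<close>. Telescoping along
  them turns the walk into a product of \<open>n\<close> elements of \<open>E\<close> of norm at most \<open>2 * R + k\<close>, followed by a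
  single lift of norm at most \<open>R\<close>.\<close>

lemma (in symmetric_generating_set) AU_walk_bound:
  fixes C :: real
  assumes E: "E \<lhd> G" and "C \<ge> 0" and "n \<ge> 1"
    and AU: "\<And>h. (\<forall>i\<in>{1..n}. h i \<in> E) \<Longrightarrow>
        real (word_norm G S (ordered_prod G h n))
          \<le> C * ln (real n) + C * real (MAX i\<in>{1..n}. word_norm G S (h i))"
    and g: "\<And>i. i \<ge> 1 \<Longrightarrow> g i \<in> carrier G" "\<And>i. i \<ge> 1 \<Longrightarrow> word_norm G S (g i) \<le> k"
    and lift: "\<And>i. i \<le> n \<Longrightarrow>
        \<exists>x\<in>carrier G. E #> x = E #> ordered_prod G g i \<and> word_norm G S x \<le> R"
  shows "real (word_norm G S (ordered_prod G g n)) \<le> C * ln (real n) + C * real (2 * R + k) + real R"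
proof -
  interpret normal E G by fact
  interpret p: group_hom G "G Mod E" "\<lambda>x. E #> x" by (rule r_coset_group_hom[OF E])
  \<comment> \<open>The choice is made for all indices at once; \<open>x 0 = \<one>\<close> starts the telescoping product at the identity,
  and the value beyond \<open>n\<close> is arbitrary.\<close>
  have "\<exists>x\<in>carrier G. (i \<le> n \<longrightarrow> E #> x = E #> ordered_prod G g i) \<and>
      word_norm G S x \<le> R \<and> (i = 0 \<longrightarrow> x = \<one>)" for i
  proof (cases "i = 0 \<or> i > n")
    case True
    then show ?thesis by (intro bexI[of _ \<one>]) auto
  next
    case False
    then show ?thesis using lift[of i] by auto
  qed
  then obtain x where x: "\<And>i. x i \<in> carrier G" "\<And>i. i \<le> n \<Longrightarrow> E #> x i = E #> ordered_prod G g i"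
    "\<And>i. word_norm G S (x i) \<le> R" "x 0 = \<one>"
    by metis
  define h where "h i = x (i - 1) \<otimes> g i \<otimes> inv (x i)" for i
  have gc: "ordered_prod G g m \<in> carrier G" for m
    using g(1) by (rule ordered_prod_closed)
  have hE: "h i \<in> E" if i: "i \<in> {1..n}" for i
  proof -
    obtain j where j: "i = Suc j" "j \<le> n" "Suc j \<le> n" using i by (cases i) auto
    have c: "g i \<in> carrier G" "ordered_prod G g j \<in> carrier G"
      using g(1)[of i] i gc by auto
    have "E #> (x j \<otimes> g i) = (E #> x j) <#> (E #> g i)"
      using x(1) c(1) by (rule rcos_sum[symmetric])
    also have "\<dots> = E #> (ordered_prod G g j \<otimes> g i)"
      unfolding x(2)[OF j(2)] using c(2,1) by (rule rcos_sum)
    also have "\<dots> = E #> x i"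
      using x(2)[OF j(3)] j(1) by simp
    finally have "x j \<otimes> g i \<otimes> inv (x i) \<in> E"
      using r_coset_eq_iff[OF E, of "x j \<otimes> g i" "x i"] x(1) c by simp
    then show ?thesis by (simp add: h_def j(1))
  qed
  have hn: "word_norm G S (h i) \<le> 2 * R + k" if i: "i \<in> {1..n}" for i
  proof -
    have gi: "g i \<in> carrier G" "word_norm G S (g i) \<le> k" using g(1,2)[of i] i by auto
    have "word_norm G S (h i) \<le> word_norm G S (x (i - 1) \<otimes> g i) + word_norm G S (inv (x i))"
      unfolding h_def using x(1) gi by (intro word_norm_mult) auto
    moreover have "word_norm G S (x (i - 1) \<otimes> g i) \<le> word_norm G S (x (i - 1)) + word_norm G S (g i)"
      using x(1) gi by (intro word_norm_mult) auto
    ultimately show ?thesis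
      using word_norm_inv[OF x(1)[of i]] x(3)[of i] x(3)[of "i - 1"] gi(2) by linarith
  qed
  have hc: "h i \<in> carrier G" if "i \<ge> 1" for i
    using x(1) g(1)[OF that] by (simp add: h_def)
  have oc: "ordered_prod G h n \<in> carrier G"
    using hc by (rule ordered_prod_closed)
  have "ordered_prod G h n \<otimes> x n = ordered_prod G g n"
    using ordered_prod_telescope[of x g n] x(1,4) g(1) gc by (simp add: h_def[abs_def])
  then have 1: "word_norm G S (ordered_prod G g n) \<le> word_norm G S (ordered_prod G h n) + R"
    using word_norm_mult[OF oc x(1)[of n]] x(3)[of n] by simp
  have "(MAX i\<in>{1..n}. word_norm G S (h i)) \<le> 2 * R + k"
    using hn \<open>n \<ge> 1\<close> by (subst Max_le_iff) auto
  then have "C * real (MAX i\<in>{1..n}. word_norm G S (h i)) \<le> C * real (2 * R + k)"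
    using \<open>C \<ge> 0\<close> by (intro mult_left_mono of_nat_mono) auto
  moreover have "real (word_norm G S (ordered_prod G h n))
      \<le> C * ln (real n) + C * real (MAX i\<in>{1..n}. word_norm G S (h i))"
    by (rule AU) (use hE in blast)
  moreover have "real (word_norm G S (ordered_prod G g n))
      \<le> real (word_norm G S (ordered_prod G h n)) + real R"
    using 1 by linarith
  ultimately show ?thesis by linarith
qed

lemma ln_le_twice_sqrt:
  assumes "x > 0"
  shows "ln x \<le> 2 * sqrt x"
  using ln_le_minus_one[of "sqrt x"] assms by (simp add: ln_sqrt)

text \<open>The AU inequality is available for one generating set \<open>S\<^sub>0\<close> only, so the estimate is made for the
  norm of \<open>S\<^sub>0\<close> and multiplied by \<open>b\<close> afterwards. The summand \<open>1\<close> in the last factor keeps that factor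
  positive when \<open>b\<close> or \<open>N\<close> is \<open>0\<close>, which is needed for rescaling \<open>t\<close> by it later.\<close>

lemma walk_norm_le_sqrt_plus_quotient_walk:
  fixes G (structure) and C :: real
  assumes S: "symmetric_generating_set G S" and S0: "symmetric_generating_set G S\<^sub>0"
    and S': "symmetric_generating_set (G Mod E) S'" and E: "E \<lhd> G" and C: "C \<ge> 0"
    and AU: "\<And>n h. n \<ge> 1 \<Longrightarrow> (\<forall>i\<in>{1..n}. h i \<in> E) \<Longrightarrow>
        real (word_norm G S\<^sub>0 (ordered_prod G h n))
          \<le> C * ln (real n) + C * real (MAX i\<in>{1..n}. word_norm G S\<^sub>0 (h i))"
    and lift: "\<And>y. y \<in> S' \<Longrightarrow> \<exists>x\<in>carrier G. E #> x = y \<and> word_norm G S\<^sub>0 x \<le> N"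
    and b: "\<And>y. y \<in> S\<^sub>0 \<Longrightarrow> word_norm G S y \<le> b"
    and g: "\<And>i. i \<ge> 1 \<Longrightarrow> g i \<in> carrier G" "\<And>i. i \<ge> 1 \<Longrightarrow> word_norm G S\<^sub>0 (g i) \<le> k"
    and n: "n \<ge> 1"
  shows "(MAX m\<in>{..n}. real (word_norm G S (ordered_prod G g m)))
      \<le> real b * C * (2 + real k) * sqrt (real n) + (real b * (2 * C + 1) * real N + 1) *
        (MAX m\<in>{..n}. real (word_norm (G Mod E) S' (ordered_prod (G Mod E) (\<lambda>i. E #> g i) m)))"
    (is "_ \<le> ?P * sqrt (real n) + ?Q * ?M")
proof -
  interpret normal E G by fact
  interpret p: group_hom G "G Mod E" "\<lambda>x. E #> x" by (rule r_coset_group_hom[OF E])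
  interpret S0: symmetric_generating_set G S\<^sub>0 by fact
  let ?v = "\<lambda>m. word_norm (G Mod E) S' (ordered_prod (G Mod E) (\<lambda>i. E #> g i) m)"
  define M where "M = (MAX m\<in>{..n}. ?v m)"
  have v: "?v m \<le> M" if "m \<le> n" for m
    unfolding M_def using that by (intro Max_ge) auto
  have "M \<in> ?v ` {..n}"
    unfolding M_def by (intro Max_in) auto
  then have M: "real M \<le> ?M"
    by (auto intro!: Max_ge)
  have gc: "ordered_prod G g m \<in> carrier G" for m
    using g(1) by (rule ordered_prod_closed)
  have lift_walk: "\<exists>x\<in>carrier G. E #> x = E #> ordered_prod G g i \<and> word_norm G S\<^sub>0 x \<le> N * M"
    if i: "i \<le> n" for i
  proof -
    have "E #> ordered_prod G g i \<in> carrier (G Mod E)"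
      using gc by (rule p.hom_closed)
    from word_norm_lift[OF p.group_hom_axioms S0 S' lift this]
    obtain x where x: "x \<in> carrier G" "E #> x = E #> ordered_prod G g i"
      "word_norm G S\<^sub>0 x \<le> N * word_norm (G Mod E) S' (E #> ordered_prod G g i)"
      by blast
    have "word_norm (G Mod E) S' (E #> ordered_prod G g i) \<le> M"
      using v[OF i] by (subst p.hom_ordered_prod[OF g(1)])
    then have "word_norm G S\<^sub>0 x \<le> N * M"
      using x(3) by (meson le_trans mult_le_mono2)
    then show ?thesis using x(1,2) by blast
  qed
  have "real (word_norm G S (ordered_prod G g m)) \<le> ?P * sqrt (real n) + ?Q * ?M" if m: "m \<le> n" for m
  proof (cases "m = 0")
    case True
    then show ?thesis
      using C M by (auto intro!: add_nonneg_nonneg mult_nonneg_nonneg)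
  next
    case False
    have "real (word_norm G S\<^sub>0 (ordered_prod G g m))
        \<le> C * ln (real m) + C * real (2 * (N * M) + k) + real (N * M)"
      using False m g lift_walk by (intro S0.AU_walk_bound[OF E C _ AU]) auto
    also have "C * ln (real m) \<le> C * (2 * sqrt (real n))"
    proof (rule mult_left_mono[OF _ C])
      have "ln (real m) \<le> ln (real n)" using False m by simp
      also have "\<dots> \<le> 2 * sqrt (real n)" using n by (intro ln_le_twice_sqrt) simp
      finally show "ln (real m) \<le> 2 * sqrt (real n)" .
    qed
    also have "C * real (2 * (N * M) + k) \<le> 2 * C * N * M + C * k * sqrt (real n)"
    proof -
      \<comment> \<open>The constant \<open>k\<close> is absorbed into the term with \<open>sqrt n\<close>, as \<open>n \<ge> 1\<close>.\<close>
      have "C * real k * 1 \<le> C * real k * sqrt (real n)"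
        using C n by (intro mult_left_mono) auto
      then show ?thesis by (simp add: algebra_simps)
    qed
    finally have 1: "real (word_norm G S\<^sub>0 (ordered_prod G g m))
        \<le> C * (2 + k) * sqrt (real n) + (2 * C + 1) * N * M"
      by (simp add: algebra_simps)
    have "group_hom G G (\<lambda>x. x)"
      by (simp add: group_hom_def group_hom_axioms_def hom_def is_group)
    from word_norm_lift[OF this S S0 _ gc[of m], of b]
    have "word_norm G S (ordered_prod G g m) \<le> b * word_norm G S\<^sub>0 (ordered_prod G g m)"
      using b S0.subset_carrier by auto
    then have "real (word_norm G S (ordered_prod G g m)) \<le> real b * real (word_norm G S\<^sub>0 (ordered_prod G g m))"
      by (metis of_nat_le_iff of_nat_mult)
    also have "\<dots> \<le> real b * (C * (2 + k) * sqrt (real n) + (2 * C + 1) * N * M)"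
      using 1 by (intro mult_left_mono) auto
    also have "\<dots> = ?P * sqrt (real n) + b * (2 * C + 1) * N * M"
      by (simp add: algebra_simps)
    also have "b * (2 * C + 1) * N * M \<le> ?Q * M"
      by (simp add: algebra_simps)
    also have "?Q * M \<le> ?Q * ?M"
      using M C by (intro mult_left_mono add_nonneg_nonneg mult_nonneg_nonneg) auto
    finally show ?thesis by simp
  qed
  then show ?thesis by (subst Max_le_iff) auto
qed

section \<open>Push-forward of measures\<close>

definition borel_of :: "'a topology \<Rightarrow> 'a measure" where
  "borel_of T = sigma (topspace T) {U. openin T U}"

lemma space_borel_of [simp]: "space (borel_of T) = topspace T"
  by (simp add: borel_of_def space_measure_of_conv)

lemma openin_in_sets_borel_of: "openin T U \<Longrightarrow> U \<in> sets (borel_of T)"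
  unfolding borel_of_def by (subst sets_measure_of) (auto dest: openin_subset)

lemma closedin_in_sets_borel_of:
  assumes "closedin T C"
  shows "C \<in> sets (borel_of T)"
proof -
  have "topspace T - C \<in> sets (borel_of T)"
    using assms by (intro openin_in_sets_borel_of) (simp add: closedin_def)
  then have "space (borel_of T) - (topspace T - C) \<in> sets (borel_of T)"
    by (rule sets.compl_sets)
  moreover have "topspace T - (topspace T - C) = C"
    using closedin_subset[OF assms] by blast
  ultimately show ?thesis by simp
qed

lemma borel_prob_measure_iff:
  "borel_prob_measure T \<mu> \<longleftrightarrow> prob_space \<mu> \<and> sets \<mu> = sets (borel_of T)"
  by (simp add: borel_prob_measure_def borel_of_def)

lemma measurable_borel_of:
  assumes f: "continuous_map T Q f"
  shows "f \<in> measurable (borel_of T) (borel_of Q)"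
  unfolding borel_of_def[of Q]
proof (rule measurable_measure_of)
  fix U assume "U \<in> {U. openin Q U}"
  then show "f -` U \<inter> space (borel_of T) \<in> sets (borel_of T)"
    using openin_in_sets_borel_of[OF openin_continuous_map_preimage[OF f, of U]]
    by (simp add: vimage_def Int_def conj_commute)
qed (use f in \<open>auto dest: openin_subset simp: continuous_map_def\<close>)

lemma borel_prob_measure_distr:
  assumes "borel_prob_measure T \<mu>" "continuous_map T Q f"
  shows "f \<in> measurable \<mu> (borel_of Q)"
    and "borel_prob_measure Q (distr \<mu> (borel_of Q) f)"
proof -
  show "f \<in> measurable \<mu> (borel_of Q)"
    using assms measurable_borel_of[OF assms(2)] measurable_cong_sets
    by (metis borel_prob_measure_iff)
  then show "borel_prob_measure Q (distr \<mu> (borel_of Q) f)"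
    using assms(1) by (simp add: borel_prob_measure_iff prob_space.prob_space_distr)
qed

lemma measure_support_subset_closed:
  assumes \<mu>: "borel_prob_measure T \<mu>" and C: "closedin T C" "measure \<mu> C = 1"
  shows "measure_support T \<mu> \<subseteq> C"
proof
  interpret prob_space \<mu> using \<mu> by (simp add: borel_prob_measure_iff)
  fix x assume x: "x \<in> measure_support T \<mu>"
  show "x \<in> C"
  proof (rule ccontr)
    assume "x \<notin> C"
    have s: "C \<in> sets \<mu>" and sp: "space \<mu> = topspace T"
      using \<mu> C closedin_in_sets_borel_of sets_eq_imp_space_eq[of \<mu> "borel_of T"]
      by (auto simp: borel_prob_measure_iff)
    have "measure \<mu> (topspace T - C) = 0"
      using prob_compl[OF s] C(2) sp by simp
    moreover have "openin T (topspace T - C)" using C(1) by blast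
    ultimately show False
      using x \<open>x \<notin> C\<close> by (fastforce simp: measure_support_def)
  qed
qed

text \<open>The image of the support is compact, hence closed in a Hausdorff space, and has full measure;
  so it contains the support of the image measure. Conversely, preimages of neighbourhoods are
  neighbourhoods.\<close>

lemma measure_support_distr:
  assumes \<mu>: "borel_prob_measure T \<mu>" and supp: "compactly_supported T \<mu>"
    and f: "continuous_map T Q f" and Q: "Hausdorff_space Q"
  shows "measure_support Q (distr \<mu> (borel_of Q) f) = f ` measure_support T \<mu>"
    and "compactly_supported Q (distr \<mu> (borel_of Q) f)"
proof -
  interpret prob_space \<mu> using \<mu> by (simp add: borel_prob_measure_iff)
  let ?\<nu> = "distr \<mu> (borel_of Q) f" and ?K = "measure_support T \<mu>"
  have f_meas: "f \<in> measurable \<mu> (borel_of Q)" and \<nu>: "borel_prob_measure Q ?\<nu>"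
    using borel_prob_measure_distr[OF \<mu> f] by auto
  have sp: "space \<mu> = topspace T"
    using \<mu> sets_eq_imp_space_eq[of \<mu> "borel_of T"] by (auto simp: borel_prob_measure_iff)
  have Kt: "?K \<subseteq> topspace T" by (auto simp: measure_support_def)
  have comp: "compactin Q (f ` ?K)"
    using supp f by (auto simp: compactly_supported_def intro: image_compactin)
  then have cl: "closedin Q (f ` ?K)"
    by (rule compactin_imp_closedin[OF Q])
  have "measure ?\<nu> (f ` ?K) = measure \<mu> (f -` f ` ?K \<inter> space \<mu>)"
    using closedin_in_sets_borel_of[OF cl] f_meas by (simp add: measure_distr)
  also have "\<dots> \<ge> measure \<mu> ?K"
    using Kt sp measurable_sets[OF f_meas closedin_in_sets_borel_of[OF cl]]
    by (intro finite_measure_mono) auto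
  finally have m1: "measure ?\<nu> (f ` ?K) = 1"
    using supp prob_space.prob_le_1[of ?\<nu> "f ` ?K"] \<nu>
    by (auto simp: compactly_supported_def borel_prob_measure_iff)
  have "f ` ?K \<subseteq> measure_support Q ?\<nu>"
  proof
    fix y assume "y \<in> f ` ?K"
    then obtain x where x: "x \<in> ?K" "y = f x" by blast
    have "measure ?\<nu> U > 0" if U: "openin Q U" "y \<in> U" for U
    proof -
      have "openin T (f -` U \<inter> space \<mu>)"
        using openin_continuous_map_preimage[OF f U(1)] by (simp add: sp vimage_def Int_def conj_commute)
      moreover have "x \<in> f -` U \<inter> space \<mu>" using x U Kt sp by auto
      ultimately have "measure \<mu> (f -` U \<inter> space \<mu>) > 0"
        using x(1) by (simp add: measure_support_def)
      then show ?thesis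
        using openin_in_sets_borel_of[OF U(1)] f_meas by (simp add: measure_distr)
    qed
    moreover have "y \<in> topspace Q"
      using x Kt f by (auto simp: continuous_map_def)
    ultimately show "y \<in> measure_support Q ?\<nu>"
      by (simp add: measure_support_def)
  qed
  then show eq: "measure_support Q ?\<nu> = f ` ?K"
    using measure_support_subset_closed[OF \<nu> cl m1] by blast
  show "compactly_supported Q ?\<nu>"
    using comp m1 by (simp add: compactly_supported_def eq)
qed

text \<open>Non-measurable sets have \<^const>\<open>measure\<close> \<open>0\<close>, so measure \<open>1\<close> entails measurability of the support.\<close>

lemma AE_in_measure_support:
  assumes \<mu>: "borel_prob_measure T \<mu>" and supp: "compactly_supported T \<mu>"
  shows "AE x in \<mu>. x \<in> measure_support T \<mu>"
proof -
  interpret prob_space \<mu> using \<mu> by (simp add: borel_prob_measure_iff)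
  have "measure_support T \<mu> \<in> sets \<mu>"
    using supp measure_notin_sets[of "measure_support T \<mu>" \<mu>]
    by (fastforce simp: compactly_supported_def)
  then show ?thesis
    using supp by (simp add: AE_in_set_eq_1 compactly_supported_def)
qed

lemma borel_measurable_indicator_times_continuous:
  fixes \<phi> :: "'a \<Rightarrow> real"
  assumes \<phi>: "continuous_map (subtopology T H) euclideanreal \<phi>" and H: "H \<in> sets (borel_of T)"
  shows "(\<lambda>x. indicat_real H x * \<phi> x) \<in> borel_measurable (borel_of T)"
proof -
  have "\<phi> \<in> borel_measurable (restrict_space (borel_of T) H)"
  proof (rule borel_measurableI)
    fix V :: "real set" assume "open V"
    then have "openin (subtopology T H) {x \<in> topspace (subtopology T H). \<phi> x \<in> V}"
      by (intro openin_continuous_map_preimage[OF \<phi>]) auto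
    then obtain U where U: "openin T U" "{x \<in> topspace (subtopology T H). \<phi> x \<in> V} = U \<inter> H"
      unfolding openin_subtopology by blast
    then have "\<phi> -` V \<inter> space (restrict_space (borel_of T) H) = H \<inter> U"
      by (auto simp: space_restrict_space)
    then show "\<phi> -` V \<inter> space (restrict_space (borel_of T) H) \<in> sets (restrict_space (borel_of T) H)"
      using openin_in_sets_borel_of[OF U(1)] by (auto simp: sets_restrict_space)
  qed
  then show ?thesis
    using H sets.Int_space_eq2[OF H]
    by (subst (asm) borel_measurable_restrict_space_iff) (auto simp del: space_borel_of)
qed

text \<open>The generated subgroup is the union of the images of the compact sets \<open>(K \<union> K\<^sup>-\<^sup>1)\<^sup>n\<close>, and compact
  subsets of a Hausdorff space are closed.\<close>

lemma generate_image_in_sets: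
  assumes G: "topological_group G T" and hom: "group_hom G Q f" and K: "compactin T K"
    and f: "continuous_map T TQ f" and TQ: "Hausdorff_space TQ"
  shows "generate Q (f ` K) \<in> sets (borel_of TQ)"
proof -
  interpret group_hom G Q f by fact
  have top: "topspace T = carrier G" and inv: "continuous_map T T (\<lambda>x. inv\<^bsub>G\<^esub> x)"
    using G by (auto simp: topological_group_def)
  let ?S = "K \<union> (\<lambda>x. inv\<^bsub>G\<^esub> x) ` K"
  have Kc: "K \<subseteq> carrier G" using compactin_subset_topspace[OF K] top by simp
  have S: "compactin T ?S"
    using K image_compactin[OF K inv] by (rule compactin_Un)
  have Sc: "?S \<subseteq> carrier G" using Kc by auto
  have "(\<lambda>x. inv\<^bsub>G\<^esub> x) ` (\<lambda>x. inv\<^bsub>G\<^esub> x) ` K = K"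
    using Kc by (force simp: image_image)
  then have Si: "(\<lambda>x. inv\<^bsub>G\<^esub> x) ` ?S = ?S"
    by (simp add: image_Un Un_commute)
  have "generate Q (f ` K) = f ` generate G ?S"
    using generate_img[OF Kc] G.generate_Un_inv[OF Kc] by simp
  also have "\<dots> = (\<Union>n. f ` set_power G ?S n)"
    using G.generate_eq_UN_set_power[OF Sc Si] by auto
  also have "\<dots> \<in> sets (borel_of TQ)"
    using compactin_imp_closedin[OF TQ image_compactin[OF compactin_set_power[OF G S] f]]
    by (intro sets.countable_UN) (auto intro: closedin_in_sets_borel_of)
  finally show ?thesis .
qed

text \<open>A character \<open>\<phi>\<close> of the subgroup generated by the image of the support pulls back to the character
  \<open>\<phi> \<circ> f\<close> of the subgroup generated by the support. The indicator functions of the two subgroups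
  need not correspond under \<open>f\<close>, but both equal \<open>1\<close> almost everywhere.\<close>

lemma centred_distr:
  assumes G: "topological_group G T" and hom: "group_hom G Q f"
    and f: "continuous_map T TQ f" and TQ: "Hausdorff_space TQ"
    and \<mu>: "borel_prob_measure T \<mu>" "compactly_supported T \<mu>" "centred G T \<mu>"
  shows "centred Q TQ (distr \<mu> (borel_of TQ) f)"
proof -
  interpret group_hom G Q f by fact
  let ?K = "measure_support T \<mu>"
  define H where "H = generate G ?K"
  define H' where "H' = generate Q (f ` ?K)"
  have Kc: "?K \<subseteq> carrier G"
    using G by (auto simp: measure_support_def topological_group_def)
  have H': "H' = f ` H" unfolding H_def H'_def by (rule generate_img[OF Kc])
  have H'_sets: "H' \<in> sets (borel_of TQ)"
    unfolding H'_def using \<mu>(2)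
    by (intro generate_image_in_sets[OF G hom _ f TQ]) (simp add: compactly_supported_def)
  have f_meas: "f \<in> measurable \<mu> (borel_of TQ)"
    by (rule borel_prob_measure_distr(1)[OF \<mu>(1) f])
  have Hc: "H \<subseteq> carrier G"
    unfolding H_def by (rule G.generate_incl[OF Kc])
  have "has_bochner_integral (distr \<mu> (borel_of TQ) f) (\<lambda>x. indicat_real H' x * \<phi> x) 0"
    if \<phi>: "continuous_map (subtopology TQ H') euclideanreal \<phi>"
      "\<And>x y. x \<in> H' \<Longrightarrow> y \<in> H' \<Longrightarrow> \<phi> (x \<otimes>\<^bsub>Q\<^esub> y) = \<phi> x + \<phi> y" for \<phi>
  proof -
    have "continuous_map (subtopology T H) (subtopology TQ H') f"
      using f H' by (auto simp: continuous_map_in_subtopology intro: continuous_map_from_subtopology)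
    then have "continuous_map (subtopology T H) euclideanreal (\<phi> \<circ> f)"
      using \<phi>(1) by (rule continuous_map_compose)
    moreover have "(\<phi> \<circ> f) (x \<otimes>\<^bsub>G\<^esub> y) = (\<phi> \<circ> f) x + (\<phi> \<circ> f) y" if "x \<in> H" "y \<in> H" for x y
      using that Hc H' \<phi>(2)[of "f x" "f y"] by (auto simp: subsetD)
    ultimately have int: "has_bochner_integral \<mu> (\<lambda>x. indicat_real H x * (\<phi> \<circ> f) x) 0"
      using \<mu>(3) unfolding centred_def H_def Let_def by blast
    have meas: "(\<lambda>x. indicat_real H' x * \<phi> x) \<in> borel_measurable (borel_of TQ)"
      by (rule borel_measurable_indicator_times_continuous[OF \<phi>(1) H'_sets])
    have "AE x in \<mu>. indicat_real H x * (\<phi> \<circ> f) x = indicat_real H' (f x) * \<phi> (f x)"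
      using AE_in_measure_support[OF \<mu>(1,2)]
    proof eventually_elim
      case (elim x)
      then have "x \<in> H" unfolding H_def by (rule generate.incl)
      then show ?case using H' by simp
    qed
    then have "has_bochner_integral \<mu> (\<lambda>x. indicat_real H' (f x) * \<phi> (f x)) 0"
      using int has_bochner_integral_cong_AE[of "\<lambda>x. indicat_real H x * (\<phi> \<circ> f) x" \<mu>
          "\<lambda>x. indicat_real H' (f x) * \<phi> (f x)" 0]
        measurable_compose[OF f_meas meas] borel_measurable_has_bochner_integral[OF int]
      by blast
    then show ?thesis
      by (intro has_bochner_integral_distr[OF meas f_meas])
  qed
  then show ?thesis
    unfolding centred_def measure_support_distr(1)[OF \<mu>(1,2) f TQ] Let_def H'_def by blast
qed

section \<open>Transfer of Gaussian tails between walks\<close>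

lemma distr_walk_space:
  assumes \<mu>: "prob_space \<mu>" and f[measurable]: "f \<in> measurable \<mu> N"
  shows "(\<lambda>\<omega> i. f (\<omega> i)) \<in> measurable (walk_space \<mu>) (walk_space (distr \<mu> N f))"
    and "distr (walk_space \<mu>) (walk_space (distr \<mu> N f)) (\<lambda>\<omega> i. f (\<omega> i)) = walk_space (distr \<mu> N f)"
proof -
  let ?\<nu> = "distr \<mu> N f" and ?F = "\<lambda>\<omega> i. f (\<omega> i)"
  have \<nu>: "prob_space ?\<nu>" by (rule prob_space.prob_space_distr[OF \<mu> f])
  interpret M: product_prob_space "\<lambda>_. \<mu>" "UNIV :: nat set"
    by (rule product_prob_spaceI) (rule \<mu>)
  interpret N: product_prob_space "\<lambda>_. ?\<nu>" "UNIV :: nat set"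
    by (rule product_prob_spaceI) (rule \<nu>)
  show F: "?F \<in> measurable (walk_space \<mu>) (walk_space ?\<nu>)"
    unfolding walk_space_def by (rule measurable_PiM_single') (auto simp: space_PiM intro: measurable_space[OF f])
  show "distr (walk_space \<mu>) (walk_space ?\<nu>) ?F = walk_space ?\<nu>"
    unfolding walk_space_def[of ?\<nu>]
  proof (rule N.PiM_eq)
    fix J :: "nat set" and A assume J: "finite J" and A: "\<And>j. j \<in> J \<Longrightarrow> A j \<in> sets ?\<nu>"
    let ?B = "\<lambda>j. f -` A j \<inter> space \<mu>"
    have "?F -` prod_emb UNIV (\<lambda>_. ?\<nu>) J (Pi\<^sub>E J A) \<inter> space (walk_space \<mu>)
        = prod_emb UNIV (\<lambda>_. \<mu>) J (Pi\<^sub>E J ?B)"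
      using measurable_space[OF f]
      by (auto simp: prod_emb_def walk_space_def space_PiM PiE_iff)
    moreover have "prod_emb UNIV (\<lambda>_. ?\<nu>) J (Pi\<^sub>E J A) \<in> sets (walk_space ?\<nu>)"
      unfolding walk_space_def using J A by (intro sets_PiM_I) auto
    ultimately have "emeasure (distr (walk_space \<mu>) (walk_space ?\<nu>) ?F)
        (prod_emb UNIV (\<lambda>_. ?\<nu>) J (Pi\<^sub>E J A)) = emeasure (walk_space \<mu>) (prod_emb UNIV (\<lambda>_. \<mu>) J (Pi\<^sub>E J ?B))"
      using F by (simp add: emeasure_distr)
    also have "\<dots> = (\<Prod>j\<in>J. emeasure \<mu> (?B j))"
      unfolding walk_space_def using J A f by (intro M.emeasure_PiM_emb) auto
    also have "\<dots> = (\<Prod>j\<in>J. emeasure ?\<nu> (A j))"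
      using A by (intro prod.cong) (auto simp: emeasure_distr)
    finally show "emeasure (distr (walk_space \<mu>) (Pi\<^sub>M UNIV (\<lambda>_. ?\<nu>)) ?F)
        (prod_emb UNIV (\<lambda>_. ?\<nu>) J (Pi\<^sub>E J A)) = (\<Prod>j\<in>J. emeasure ?\<nu> (A j))"
      by (simp add: walk_space_def)
  qed simp
qed

text \<open>The threshold \<open>t = 2 * P\<close> separates two regimes. Above it, the term \<open>P * sqrt n\<close> accounts for at
  most half of \<open>t * sqrt n\<close>, so \<open>w'\<close> reaches distance \<open>t / (2 * Q) * sqrt n\<close> from its start. Below it,
  the trivial bound \<open>1\<close> on the probability is absorbed into the constant factor. The events may be
  non-measurable; still, outer measure does not increase under preimages by a measure-preserving
  map, since measurable covers pull back to measurable covers.\<close>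

lemma maximally_diffusive_transfer:
  fixes P Q :: real
  assumes M: "prob_space M" and F: "F \<in> measurable M M'" "distr M M' F = M'"
    and md: "maximally_diffusive M' d' w'" and PQ: "P \<ge> 0" "Q > 0"
    and bound: "AE \<omega> in M. \<forall>n\<ge>1. (MAX i\<in>{..n}. d (w 0 \<omega>) (w i \<omega>))
        \<le> P * sqrt (real n) + Q * (MAX i\<in>{..n}. d' (w' 0 (F \<omega>)) (w' i (F \<omega>)))"
  shows "maximally_diffusive M d w"
proof -
  interpret prob_space M by fact
  define A where "A n t = {\<omega> \<in> space M. 1 / sqrt (real n) * (MAX i\<in>{..n}. d (w 0 \<omega>) (w i \<omega>)) \<ge> t}" for n t
  define A' where "A' n t = {\<omega> \<in> space M'. 1 / sqrt (real n) * (MAX i\<in>{..n}. d' (w' 0 \<omega>) (w' i \<omega>)) \<ge> t}" for n t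
  from md obtain c1 c2 where c: "c1 > 0" "c2 > 0"
    and c12: "\<And>t. t > 0 \<Longrightarrow> (SUP n\<in>{1..}. outer_measure_of M' (A' n t)) \<le> ennreal (c2 * exp (- c1 * t\<^sup>2))"
    unfolding maximally_diffusive_def A'_def by blast
  obtain N where N: "{\<omega> \<in> space M. \<not> (\<forall>n\<ge>1. (MAX i\<in>{..n}. d (w 0 \<omega>) (w i \<omega>))
        \<le> P * sqrt (real n) + Q * (MAX i\<in>{..n}. d' (w' 0 (F \<omega>)) (w' i (F \<omega>))))} \<subseteq> N"
      "emeasure M N = 0" "N \<in> sets M"
    using bound by (rule AE_E)
  have outer_le: "outer_measure_of M B \<le> emeasure M D" if "B \<subseteq> D" "D \<in> sets M" for B D
    using outer_measure_of_mono[OF that(1), of M] that(2) by simp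
  have large: "outer_measure_of M (A n t) \<le> ennreal (c2 * exp (- c1 * (t / (2 * Q))\<^sup>2))"
    if t: "t > 0" "t \<ge> 2 * P" and n: "n \<ge> 1" for n t
  proof -
    obtain B where B: "B \<in> sets M'" "A' n (t / (2 * Q)) \<subseteq> B"
      "outer_measure_of M' (A' n (t / (2 * Q))) = emeasure M' B"
      using outer_measure_of_attain[of "A' n (t / (2 * Q))" M'] by (auto simp: A'_def)
    have "A n t \<subseteq> (F -` B \<inter> space M) \<union> N"
    proof
      fix \<omega> assume \<omega>: "\<omega> \<in> A n t"
      then have sp: "\<omega> \<in> space M" by (simp add: A_def)
      show "\<omega> \<in> (F -` B \<inter> space M) \<union> N"
      proof (cases "\<omega> \<in> N")
        case False
        let ?m = "MAX i\<in>{..n}. d (w 0 \<omega>) (w i \<omega>)" and ?m' = "MAX i\<in>{..n}. d' (w' 0 (F \<omega>)) (w' i (F \<omega>))"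
        have s: "sqrt (real n) > 0" using n by simp
        have "t * sqrt (real n) \<le> ?m"
          using \<omega> s by (simp add: A_def field_simps)
        also have "\<dots> \<le> P * sqrt (real n) + Q * ?m'"
          using False N(1) sp n by blast
        also have "P * sqrt (real n) \<le> t / 2 * sqrt (real n)"
          using t s by (intro mult_right_mono) auto
        finally have "t / (2 * Q) \<le> 1 / sqrt (real n) * ?m'"
          using s PQ(2) by (simp add: field_simps)
        then have "F \<omega> \<in> A' n (t / (2 * Q))"
          using measurable_space[OF F(1) sp] by (simp add: A'_def)
        then show ?thesis using B(2) sp by auto
      qed simp
    qed
    moreover have meas: "F -` B \<inter> space M \<in> sets M"
      using F(1) B(1) by (rule measurable_sets)
    ultimately have "outer_measure_of M (A n t) \<le> emeasure M ((F -` B \<inter> space M) \<union> N)"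
      using N(3) by (intro outer_le) auto
    also have "\<dots> \<le> emeasure M (F -` B \<inter> space M) + emeasure M N"
      using meas N(3) by (rule emeasure_subadditive)
    also have "\<dots> = emeasure (distr M M' F) B"
      using N(2) F(1) B(1) by (simp add: emeasure_distr)
    also have "\<dots> = outer_measure_of M' (A' n (t / (2 * Q)))"
      using F(2) B(3) by simp
    also have "\<dots> \<le> (SUP n\<in>{1..}. outer_measure_of M' (A' n (t / (2 * Q))))"
      using n by (intro SUP_upper) auto
    also have "\<dots> \<le> ennreal (c2 * exp (- c1 * (t / (2 * Q))\<^sup>2))"
      using t PQ by (intro c12) auto
    finally show ?thesis .
  qed
  \<comment> \<open>These are the constants that rescaling \<open>t\<close> by \<open>2 * Q\<close> and the trivial bound for \<open>t < 2 * P\<close> require.\<close>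
  define e1 where "e1 = c1 / (4 * Q\<^sup>2)"
  define e2 where "e2 = c2 + exp (e1 * (2 * P)\<^sup>2)"
  have e: "e1 > 0" "e2 > 0"
    using c PQ unfolding e1_def e2_def by (auto intro!: add_pos_pos)
  have "outer_measure_of M (A n t) \<le> ennreal (e2 * exp (- e1 * t\<^sup>2))" if t: "t > 0" and n: "n \<ge> 1" for n t
  proof (cases "t \<ge> 2 * P")
    case True
    have "c2 * exp (- c1 * (t / (2 * Q))\<^sup>2) = c2 * exp (- e1 * t\<^sup>2)"
      by (simp add: e1_def power_divide power_mult_distrib)
    also have "\<dots> \<le> e2 * exp (- e1 * t\<^sup>2)"
      by (intro mult_right_mono) (auto simp: e2_def)
    finally show ?thesis
      using large[OF t True n] by (meson ennreal_leI order_trans)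
  next
    case False
    have "outer_measure_of M (A n t) \<le> emeasure M (space M)"
      by (rule outer_le) (auto simp: A_def)
    also have "\<dots> = ennreal 1" by (simp add: emeasure_space_1)
    also have "\<dots> \<le> ennreal (e2 * exp (- e1 * t\<^sup>2))"
    proof (rule ennreal_leI)
      have "t\<^sup>2 \<le> (2 * P)\<^sup>2" using False t by (intro power_mono) auto
      then have "1 \<le> exp (e1 * (2 * P)\<^sup>2) * exp (- e1 * t\<^sup>2)"
        using e(1) by (simp add: exp_add[symmetric] mult_left_mono)
      also have "\<dots> \<le> e2 * exp (- e1 * t\<^sup>2)"
        using c by (intro mult_right_mono) (auto simp: e2_def)
      finally show "1 \<le> e2 * exp (- e1 * t\<^sup>2)" .
    qed
    finally show ?thesis .
  qed
  then have "\<forall>t>0. (SUP n\<in>{1..}. outer_measure_of M (A n t)) \<le> ennreal (e2 * exp (- e1 * t\<^sup>2))"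
    by (auto intro!: SUP_least)
  then show ?thesis
    unfolding maximally_diffusive_def A_def using e by blast
qed

section \<open>Maximal diffusivity passes from the quotient to the group\<close>

lemma (in group) word_dist_random_walk:
  assumes "\<And>i. i \<ge> 1 \<Longrightarrow> \<omega> i \<in> carrier G"
  shows "word_dist G S (random_walk G 0 \<omega>) (random_walk G n \<omega>) = real (word_norm G S (ordered_prod G \<omega> n))"
  using ordered_prod_closed[of \<omega> n, OF assms] by (simp add: word_dist_def random_walk_def)

theorem proposition1p6:
  fixes G :: "('a, 'b) monoid_scheme" and T :: "'a topology"
    and E S :: "'a set" and S' :: "'a set set"
  assumes "locally_compact_group G T"
    and "compactly_generated G T"
    and "compact_generating_set G T S"
    and "E \<lhd> G" and "closedin T E" and "AU_subgroup G T E"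
    and "compact_generating_set (G Mod E) (quotient_group_topology G T E) S'"
    and "\<forall>\<nu>. borel_prob_measure (quotient_group_topology G T E) \<nu> \<and>
              compactly_supported (quotient_group_topology G T E) \<nu> \<and>
              centred (G Mod E) (quotient_group_topology G T E) \<nu> \<longrightarrow>
              maximally_diffusive (walk_space \<nu>) (word_dist (G Mod E) S') (random_walk (G Mod E))"
  shows "\<forall>\<mu>. borel_prob_measure T \<mu> \<and> compactly_supported T \<mu> \<and> centred G T \<mu> \<longrightarrow>
              maximally_diffusive (walk_space \<mu>) (word_dist G S) (random_walk G)"
proof (intro allI impI, elim conjE)
  fix \<mu> assume \<mu>: "borel_prob_measure T \<mu>" "compactly_supported T \<mu>" "centred G T \<mu>"
  let ?Q = "quotient_group_topology G T E" and ?p = "\<lambda>x. E #>\<^bsub>G\<^esub> x"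
  define \<nu> where "\<nu> = distr \<mu> (borel_of ?Q) ?p"
  have tg: "topological_group G T"
    using assms(1) by (simp add: locally_compact_group_def)
  then have top: "topspace T = carrier G" and "group G"
    by (auto simp: topological_group_def)
  interpret p: group_hom G "G Mod E" ?p by (rule r_coset_group_hom) fact
  have quot: "quotient_map T ?Q ?p"
    by (rule quotient_map_quotient_group_topology[OF top])
  then have cont: "continuous_map T ?Q ?p" and surj: "?p ` topspace T = topspace ?Q"
    by (auto simp: quotient_imp_continuous_map quotient_map_def)
  have topQ: "topspace ?Q = carrier (G Mod E)"
    using surj by (simp add: top carrier_FactGroup)
  have open_p: "open_map T ?Q ?p"
    by (rule open_map_quotient_group[OF tg assms(4)])
  have Haus: "Hausdorff_space ?Q"
    by (rule Hausdorff_quotient_group[OF tg assms(4,5)])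
  have p_meas: "?p \<in> measurable \<mu> (borel_of ?Q)" and "borel_prob_measure ?Q \<nu>"
    using borel_prob_measure_distr[OF \<mu>(1) cont] by (auto simp: \<nu>_def)
  moreover have "compactly_supported ?Q \<nu>"
    unfolding \<nu>_def by (rule measure_support_distr(2)[OF \<mu>(1,2) cont Haus])
  moreover have "centred (G Mod E) ?Q \<nu>"
    unfolding \<nu>_def by (rule centred_distr[OF tg p.group_hom_axioms cont Haus \<mu>])
  ultimately have md: "maximally_diffusive (walk_space \<nu>) (word_dist (G Mod E) S') (random_walk (G Mod E))"
    using assms(8) by blast

  from \<open>AU_subgroup G T E\<close> obtain S\<^sub>0 C where S0: "compact_generating_set G T S\<^sub>0" and C: "C \<ge> 1"
    and AU: "\<And>n h. n \<ge> 1 \<Longrightarrow> (\<forall>i\<in>{1..n}. h i \<in> E) \<Longrightarrow>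
        real (word_norm G S\<^sub>0 (ordered_prod G h n))
          \<le> C * ln (real n) + C * real (MAX i\<in>{1..n}. word_norm G S\<^sub>0 (h i))"
    unfolding AU_subgroup_def by blast
  have id: "open_map T T (\<lambda>x. x)" "(\<lambda>x. x) ` topspace T = topspace T"
    by (auto simp: open_map_def)
  obtain N where N: "\<forall>y\<in>S'. \<exists>x\<in>carrier G. E #>\<^bsub>G\<^esub> x = y \<and> word_norm G S\<^sub>0 x \<le> N"
    using compactin_lift_word_norm_bounded[OF assms(1) S0 open_p surj, of S'] assms(7)
    by (auto simp: compact_generating_set_def)
  obtain k where k: "\<forall>y\<in>measure_support T \<mu>. word_norm G S\<^sub>0 y \<le> k"
    using compactin_lift_word_norm_bounded[OF assms(1) S0 id, of "measure_support T \<mu>"] \<mu>(2)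
    by (auto simp: compactly_supported_def)
  obtain b where b: "\<forall>y\<in>S\<^sub>0. word_norm G S y \<le> b"
    using compactin_lift_word_norm_bounded[OF assms(1,3) id, of S\<^sub>0] S0
    by (auto simp: compact_generating_set_def)
  have sym: "symmetric_generating_set G S" "symmetric_generating_set G S\<^sub>0"
    "symmetric_generating_set (G Mod E) S'"
    using compact_generating_set_imp_symmetric \<open>group G\<close> top assms(3,7) S0 topQ p.H.is_group
    by blast+

  have prob: "prob_space \<mu>"
    using \<mu>(1) by (simp add: borel_prob_measure_iff)
  have "AE \<omega> in walk_space \<mu>. \<forall>i. \<omega> i \<in> measure_support T \<mu>"
    unfolding walk_space_def AE_all_countable
    by (intro allI AE_PiM_component prob AE_in_measure_support[OF \<mu>(1,2)]) auto
  then have bound: "AE \<omega> in walk_space \<mu>. \<forall>n\<ge>1.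
      (MAX i\<in>{..n}. word_dist G S (random_walk G 0 \<omega>) (random_walk G i \<omega>))
        \<le> real b * C * (2 + real k) * sqrt (real n) + (real b * (2 * C + 1) * real N + 1) *
          (MAX i\<in>{..n}. word_dist (G Mod E) S' (random_walk (G Mod E) 0 (\<lambda>i. ?p (\<omega> i)))
            (random_walk (G Mod E) i (\<lambda>i. ?p (\<omega> i))))"
  proof eventually_elim
    case (elim \<omega>)
    then have \<omega>: "\<omega> i \<in> carrier G" "word_norm G S\<^sub>0 (\<omega> i) \<le> k" for i
      using k top by (auto simp: measure_support_def)
    then have p\<omega>: "?p (\<omega> i) \<in> carrier (G Mod E)" for i
      by (intro p.hom_closed)
    show ?case
      unfolding p.G.word_dist_random_walk[of \<omega>, OF \<omega>(1)]
        p.H.word_dist_random_walk[of "\<lambda>i. ?p (\<omega> i)", OF p\<omega>]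
    proof (intro allI impI)
      fix n :: nat assume "n \<ge> 1"
      with C N b \<omega> AU show "(MAX i\<in>{..n}. real (word_norm G S (ordered_prod G \<omega> i)))
        \<le> real b * C * (2 + real k) * sqrt (real n) + (real b * (2 * C + 1) * real N + 1) *
          (MAX i\<in>{..n}. real (word_norm (G Mod E) S' (ordered_prod (G Mod E) (\<lambda>i. ?p (\<omega> i)) i)))"
        by (intro walk_norm_le_sqrt_plus_quotient_walk[OF sym assms(4)]) auto
    qed
  qed
  show "maximally_diffusive (walk_space \<mu>) (word_dist G S) (random_walk G)"
  proof (rule maximally_diffusive_transfer[where F = "\<lambda>\<omega> i. ?p (\<omega> i)"
        and M = "walk_space \<mu>" and d = "word_dist G S" and w = "random_walk G"
        and M' = "walk_space \<nu>" and d' = "word_dist (G Mod E) S'" and w' = "random_walk (G Mod E)"])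
    show "maximally_diffusive (walk_space \<nu>) (word_dist (G Mod E) S') (random_walk (G Mod E))"
      by (rule md)
    show "AE \<omega> in walk_space \<mu>. \<forall>n\<ge>1.
      (MAX i\<in>{..n}. word_dist G S (random_walk G 0 \<omega>) (random_walk G i \<omega>))
        \<le> real b * C * (2 + real k) * sqrt (real n) + (real b * (2 * C + 1) * real N + 1) *
          (MAX i\<in>{..n}. word_dist (G Mod E) S' (random_walk (G Mod E) 0 (\<lambda>i. ?p (\<omega> i)))
            (random_walk (G Mod E) i (\<lambda>i. ?p (\<omega> i))))"
      by (rule bound)
    show "prob_space (walk_space \<mu>)"
      unfolding walk_space_def by (intro prob_space_PiM prob)
    show "(\<lambda>\<omega> i. ?p (\<omega> i)) \<in> measurable (walk_space \<mu>) (walk_space \<nu>)"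
      "distr (walk_space \<mu>) (walk_space \<nu>) (\<lambda>\<omega> i. ?p (\<omega> i)) = walk_space \<nu>"
      unfolding \<nu>_def by (rule distr_walk_space[OF prob p_meas])+
    show "0 \<le> real b * C * (2 + real k)" "0 < real b * (2 * C + 1) * real N + 1"
      using C by (auto intro!: add_nonneg_pos)
  qed
qed

end
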